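(* Let $\Lambda=\Lambda_0\oplus\Lambda_1$ be a finite-dimensional real commutative superalgebra satisfying conditions $(A_0)$ and $(A_1)$. Every $\Lambda$-valued function that is qS-differentiable and bounded in norm on $\Lambda_0^n\times\Lambda_1^m$ is constant.
   Context: A real commutative superalgebra (CSA) is an associative unital real algebra with a grading $\Lambda=\Lambda_0\oplus\Lambda_1$, $\Lambda_i\Lambda_j\subset\Lambda_{i+j \bmod 2}$, such that $ab=(-1)^{\sigma(a)\sigma(b)}ba$ for homogeneous $a,b$, where $\sigma(a)=i$ for $a\in\Lambda_i$. Condition $(A_0)$: there is a basis $(e_0=1,e_1,\dots,e_p)$ of $\Lambda_0$ with $\sum_{k=0}^p e_k^2=0$. Condition $(A_1)$: there are a basis $(\varepsilon_1,\dots,\varepsilon_q)$ of $\Lambda_1$, integers $1=s_1<s_2<\dots<s_r<s_{r+1}=q+1$ and elements $a_1,\dots,a_q\in\Lambda_0$ such that $\varepsilon_j=a_j\varepsilon_{s_k}$ whenever $s_k\le j<s_{k+1}$, $a_{s_1}=\dots=a_{s_r}=e_0$, and $\sum_{j=s_k}^{s_{k+1}-1}a_j^2=0$ for every $k=1,\dots,r$. Such bases and elements are fixed. A point of $\Lambda_0^n\times\Lambda_1^m$ is written $(y_1,\dots,y_n,\theta_1,\dots,\theta_m)$ with $y_i=\sum_{k=0}^p y_i^k e_k$, $\theta_i=\sum_{l=1}^q\theta_i^l\varepsilon_l$, where $y_i^k,\theta_i^l$ are real coordinates. For a Fréchet-differentiable (over $\mathbb R$) function $f$ with values in $\Lambda$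 put $$d''f=\sum_{i=1}^n\sum_{j=1}^p \Big(\frac{\partial f}{\partial y_i^j}-e_j\frac{\partial f}{\partial y_i^0}\Big)dy_i^j+\sum_{i=1}^m\sum_{k=1}^r\sum_{t=s_k+1}^{s_{k+1}-1}\Big(\frac{\partial f}{\partial\theta_i^t}-a_t\frac{\partial f}{\partial\theta_i^{s_k}}\Big)d\theta_i^t .$$ A function is qS-differentiable on an open set if it is Fréchet-differentiable there and $d''f\equiv0$. *)

theory Defs
  imports "HOL-Analysis.Analysis"
begin

(* The algebra is the whole type 'a, with an arbitrary norm (not assumed submultiplicative);
   the grading is given by the two subspaces \<Lambda> 0 and \<Lambda> 1. *)
definition commutative_superalgebra ::
    "(nat \<Rightarrow> 'a::real_algebra_1 set) \<Rightarrow> bool" where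
  "commutative_superalgebra \<Lambda> \<longleftrightarrow>
     subspace (\<Lambda> 0) \<and> subspace (\<Lambda> 1) \<and>
     \<Lambda> 0 \<inter> \<Lambda> 1 = {0} \<and>
     (\<forall>x. \<exists>a\<in>\<Lambda> 0. \<exists>b\<in>\<Lambda> 1. x = a + b) \<and>
     (\<forall>i\<in>{0,1}. \<forall>j\<in>{0,1}. \<forall>a\<in>\<Lambda> i. \<forall>b\<in>\<Lambda> j.
        a * b \<in> \<Lambda> ((i + j) mod 2) \<and> a * b = (-1) ^ (i * j) * (b * a))"

definition finite_dimensional_type :: "'a::real_vector itself \<Rightarrow> bool" where
  "finite_dimensional_type _ \<longleftrightarrow> (\<exists>B :: 'a set. finite B \<and> span B = UNIV)"

definition basis_family :: "(nat \<Rightarrow> 'a::real_vector) \<Rightarrow> nat set \<Rightarrow> 'a set \<Rightarrow> bool" where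
  "basis_family b K V \<longleftrightarrow> inj_on b K \<and> independent (b ` K) \<and> span (b ` K) = V"

definition condition_A0 ::
    "(nat \<Rightarrow> 'a::real_algebra_1 set) \<Rightarrow> nat \<Rightarrow> (nat \<Rightarrow> 'a) \<Rightarrow> bool" where
  "condition_A0 \<Lambda> p e \<longleftrightarrow>
     basis_family e {0..p} (\<Lambda> 0) \<and> e 0 = 1 \<and> (\<Sum>k=0..p. (e k)\<^sup>2) = 0"

(* The case q = r = 0, i.e. a trivial odd part, is allowed. *)
definition condition_A1 ::
    "(nat \<Rightarrow> 'a::real_algebra_1 set) \<Rightarrow> nat \<Rightarrow> (nat \<Rightarrow> 'a) \<Rightarrow> nat \<Rightarrow> (nat \<Rightarrow> nat) \<Rightarrow> (nat \<Rightarrow> 'a) \<Rightarrow> bool" where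
  "condition_A1 \<Lambda> q \<epsilon> r s a \<longleftrightarrow>
     basis_family \<epsilon> {1..q} (\<Lambda> 1) \<and>
     s 1 = 1 \<and> s (r + 1) = q + 1 \<and> strict_mono_on {1..r+1} s \<and>
     (\<forall>j\<in>{1..q}. a j \<in> \<Lambda> 0) \<and>
     (\<forall>k\<in>{1..r}. \<forall>j. s k \<le> j \<and> j < s (k + 1) \<longrightarrow> \<epsilon> j = a j * \<epsilon> (s k)) \<and>
     (\<forall>k\<in>{1..r}. a (s k) = 1) \<and>
     (\<forall>k\<in>{1..r}. (\<Sum>j = s k..s (k + 1) - 1. (a j)\<^sup>2) = 0)"

(* The superspace with n = card I even and m = card J odd coordinates. Coordinates outside I and J
   are frozen at 0; index sets rather than whole index types so that n = 0 and m = 0 are covered. *)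
definition superspace ::
    "(nat \<Rightarrow> 'a::real_vector set) \<Rightarrow> 'n::finite set \<Rightarrow> 'm::finite set \<Rightarrow> (('a ^ 'n) \<times> ('a ^ 'm)) set" where
  "superspace \<Lambda> I J =
     {(y, \<theta>). (\<forall>i\<in>I. y $ i \<in> \<Lambda> 0) \<and> (\<forall>i. i \<notin> I \<longrightarrow> y $ i = 0) \<and>
              (\<forall>i\<in>J. \<theta> $ i \<in> \<Lambda> 1) \<and> (\<forall>i. i \<notin> J \<longrightarrow> \<theta> $ i = 0)}"

definition partial_even ::
    "(('a ^ 'n) \<times> ('a ^ 'm) \<Rightarrow> 'a) \<Rightarrow> 'n::finite \<Rightarrow> 'a \<Rightarrow> ('a ^ 'n) \<times> ('a ^ 'm::finite) \<Rightarrow> 'a::real_normed_vector" where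
  "partial_even f i b x = vector_derivative (\<lambda>t. f (x + t *\<^sub>R (axis i b, 0))) (at 0)"

definition partial_odd ::
    "(('a ^ 'n) \<times> ('a ^ 'm) \<Rightarrow> 'a) \<Rightarrow> 'm::finite \<Rightarrow> 'a \<Rightarrow> ('a ^ 'n::finite) \<times> ('a ^ 'm) \<Rightarrow> 'a::real_normed_vector" where
  "partial_odd f i b x = vector_derivative (\<lambda>t. f (x + t *\<^sub>R (0, axis i b))) (at 0)"

(* The value of the 1-form d''f at the point x on the tangent vector (u, \<eta>); the real numbers
   representation ... are the values of the coordinate differentials of y_i^j and \<theta>_i^t. *)
definition d''_form ::
    "nat \<Rightarrow> (nat \<Rightarrow> 'a) \<Rightarrow> nat \<Rightarrow> (nat \<Rightarrow> 'a) \<Rightarrow> nat \<Rightarrow> (nat \<Rightarrow> nat) \<Rightarrow> (nat \<Rightarrow> 'a) \<Rightarrow> 'n set \<Rightarrow> 'm set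
     \<Rightarrow> (('a ^ 'n::finite) \<times> ('a ^ 'm::finite) \<Rightarrow> 'a) \<Rightarrow> ('a ^ 'n) \<times> ('a ^ 'm) \<Rightarrow> ('a ^ 'n) \<times> ('a ^ 'm)
     \<Rightarrow> 'a::{real_normed_vector, real_algebra_1}" where
  "d''_form p e q \<epsilon> r s a I J f x = (\<lambda>(u, \<eta>).
     (\<Sum>i\<in>I. \<Sum>j=1..p.
        representation (e ` {0..p}) (u $ i) (e j) *\<^sub>R
          (partial_even f i (e j) x - e j * partial_even f i (e 0) x)) +
     (\<Sum>i\<in>J. \<Sum>k=1..r. \<Sum>t = s k + 1..s (k + 1) - 1.
        representation (\<epsilon> ` {1..q}) (\<eta> $ i) (\<epsilon> t) *\<^sub>R
          (partial_odd f i (\<epsilon> t) x - a t * partial_odd f i (\<epsilon> (s k)) x)))"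

(* Frechet differentiability is relative to the superspace, a linear subspace of the ambient type;
   the partial derivatives only involve directions lying in it. *)
definition qS_differentiable_on ::
    "(nat \<Rightarrow> 'a set) \<Rightarrow> nat \<Rightarrow> (nat \<Rightarrow> 'a) \<Rightarrow> nat \<Rightarrow> (nat \<Rightarrow> 'a) \<Rightarrow> nat \<Rightarrow> (nat \<Rightarrow> nat) \<Rightarrow> (nat \<Rightarrow> 'a)
     \<Rightarrow> 'n set \<Rightarrow> 'm set \<Rightarrow> (('a ^ 'n::finite) \<times> ('a ^ 'm::finite) \<Rightarrow> 'a::{real_normed_vector, real_algebra_1})
     \<Rightarrow> (('a ^ 'n) \<times> ('a ^ 'm)) set \<Rightarrow> bool" where
  "qS_differentiable_on \<Lambda> p e q \<epsilon> r s a I J f U \<longleftrightarrow>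
     openin (top_of_set (superspace \<Lambda> I J)) U \<and>
     (\<forall>x\<in>U. f differentiable (at x within superspace \<Lambda> I J) \<and>
        (\<forall>v\<in>superspace \<Lambda> I J. d''_form p e q \<epsilon> r s a I J f x v = 0))"

end

(* On each block of coordinates the partial derivatives of f are a_t * g with commuting elements a_t,
   one of which is 1, whose squares sum to 0. If g is not identically 0, triangularising the
   multiplications by the a_t on the dual of the algebra gives a complex functional \<psi> with
   \<psi>(a_t m) = c_t \<psi>(m) on the span of the values of g under the a_t, and \<psi> is not 0 there. Then the
   squares of the c_t sum to 0 and some c_t is 1, so some c_t is not real, and \<psi> \<circ> f is a bounded entire
   function in the plane of the corresponding two directions. By Liouville \<psi> \<circ> g = 0, a contradiction.
   This needs no regularity beyond differentiability, unlike an argument through harmonicity of f. *)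
theory Submission
  imports Defs "HOL-Complex_Analysis.Cauchy_Integral_Formula"
    "HOL-Computational_Algebra.Fundamental_Theorem_Algebra"
begin

section \<open>Continuity of linear maps for an arbitrary norm in finite dimension\<close>

text \<open>Coefficient vectors with absolute values summing to 1 form a compact set, so the norm of
  the combination attains a minimum there. Independence makes the minimum positive, and homogeneity
  extends the bound to all coefficients.\<close>

lemma norm_linear_combination_ge:
  fixes B :: "'a::real_normed_vector set"
  assumes fin: "finite B" and ind: "independent B"
  obtains m where "m > 0" "\<And>c. m * (\<Sum>b\<in>B. \<bar>c b\<bar>) \<le> norm (\<Sum>b\<in>B. c b *\<^sub>R b)"
proof (cases "B = {}")
  case True
  then show ?thesis using that[of 1] by simp
next
  case False
  \<comment> \<open>Coefficients outside \<open>B\<close> are pinned to 0, so that the candidates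
    form a product of compact sets in the function space and Tychonoff's theorem applies.\<close>
  let ?S = "\<lambda>i. if i \<in> B then {-1..1::real} else {0}"
  let ?C = "PiE UNIV ?S \<inter> {c. (\<Sum>b\<in>B. \<bar>c b\<bar>) = 1}"
  have "compactin (product_topology (\<lambda>_. euclidean) UNIV) (PiE UNIV ?S)"
    by (subst compactin_PiE) auto
  then have "compact (PiE UNIV ?S)"
    by (simp add: euclidean_product_topology)
  moreover have "continuous_on UNIV (\<lambda>c::'a \<Rightarrow> real. \<Sum>b\<in>B. \<bar>c b\<bar>)"
    by (intro continuous_intros continuous_on_product_coordinates)
  then have "closed {c::'a \<Rightarrow> real. (\<Sum>b\<in>B. \<bar>c b\<bar>) = 1}"
    by (intro closed_Collect_eq) auto
  ultimately have comp: "compact ?C"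
    by (rule compact_Int_closed)
  obtain b0 where "b0 \<in> B" using False by blast
  have "(\<lambda>b. if b = b0 then 1 else 0) \<in> ?C"
    using \<open>b0 \<in> B\<close> fin by (auto simp: if_distrib[of abs] sum.delta cong: if_cong)
  then have ne: "?C \<noteq> {}" by blast
  have "continuous_on ?C (\<lambda>c. norm (\<Sum>b\<in>B. c b *\<^sub>R b))"
    by (rule continuous_on_subset[of UNIV]) (intro continuous_intros continuous_on_product_coordinates, auto)
  from continuous_attains_inf[OF comp ne this] obtain c0 where c0: "c0 \<in> ?C"
    and min: "\<And>c. c \<in> ?C \<Longrightarrow> norm (\<Sum>b\<in>B. c0 b *\<^sub>R b) \<le> norm (\<Sum>b\<in>B. c b *\<^sub>R b)"
    by blast
  let ?m = "norm (\<Sum>b\<in>B. c0 b *\<^sub>R b)"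
  have "?m \<noteq> 0"
  proof
    assume "?m = 0"
    then have "c0 b = 0" if "b \<in> B" for b
      using independentD[OF ind fin subset_refl _ that, of c0] by simp
    then have "(\<Sum>b\<in>B. \<bar>c0 b\<bar>) = 0" by simp
    with c0 show False by simp
  qed
  then have "?m > 0" by simp
  moreover have "?m * (\<Sum>b\<in>B. \<bar>c b\<bar>) \<le> norm (\<Sum>b\<in>B. c b *\<^sub>R b)" for c :: "'a \<Rightarrow> real"
  proof (cases "(\<Sum>b\<in>B. \<bar>c b\<bar>) = 0")
    case True
    then show ?thesis by simp
  next
    case False
    define s where "s = (\<Sum>b\<in>B. \<bar>c b\<bar>)"
    have s: "s > 0" using False unfolding s_def
      by (metis abs_ge_zero order_le_less sum_nonneg)
    \<comment> \<open>This is \<open>c\<close> rescaled to the unit sphere and cut off outside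
      \<open>B\<close>, hence a competitor for the minimum.\<close>
    define d where "d = (\<lambda>b. if b \<in> B then c b / s else 0)"
    have le: "\<bar>c b\<bar> \<le> s" if "b \<in> B" for b
      unfolding s_def using fin that by (intro member_le_sum) auto
    have "(\<Sum>b\<in>B. \<bar>d b\<bar>) = (\<Sum>b\<in>B. \<bar>c b\<bar> / s)"
      using s by (intro sum.cong) (auto simp: d_def)
    also have "\<dots> = 1" using s by (simp add: s_def flip: sum_divide_distrib)
    finally have "(\<Sum>b\<in>B. \<bar>d b\<bar>) = 1" .
    moreover have "d \<in> PiE UNIV ?S"
    proof
      fix x :: 'a
      show "d x \<in> ?S x"
        using le[of x] s by (auto simp: d_def abs_le_iff field_simps)
    qed simp
    ultimately have "?m \<le> norm (\<Sum>b\<in>B. d b *\<^sub>R b)"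
      by (intro min) simp
    also have "(\<Sum>b\<in>B. d b *\<^sub>R b) = (1 / s) *\<^sub>R (\<Sum>b\<in>B. c b *\<^sub>R b)"
      unfolding scaleR_sum_right by (intro sum.cong) (auto simp: d_def)
    also have "norm \<dots> = norm (\<Sum>b\<in>B. c b *\<^sub>R b) / s" using s by simp
    finally show ?thesis using s by (simp add: field_simps flip: s_def)
  qed
  ultimately show ?thesis by (rule that)
qed

lemma finite_dimensional_typeE:
  assumes "finite_dimensional_type TYPE('a::real_vector)"
  obtains B :: "'a::real_vector set" where "finite B" "independent B" "span B = UNIV"
proof -
  obtain C :: "'a set" where C: "finite C" "span C = UNIV"
    using assms unfolding finite_dimensional_type_def by blast
  obtain B where B: "B \<subseteq> C" "independent B" "C \<subseteq> span B"
    by (rule maximal_independent_subset)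
  then have "span B = UNIV"
    using span_minimal[OF B(3) subspace_span] C(2) by auto
  then show ?thesis using that B C finite_subset by blast
qed

text \<open>The coordinates of \<open>x\<close> are bounded by a multiple of \<open>norm x\<close>,
  by the previous estimate. This is what lets an algebraically constructed functional be composed
  with \<open>f\<close> without losing differentiability or boundedness.\<close>

lemma linear_imp_bounded_linear:
  fixes h :: "'a::real_normed_vector \<Rightarrow> 'b::real_normed_vector"
  assumes fd: "finite_dimensional_type TYPE('a)" and h: "linear h"
  shows "bounded_linear h"
proof -
  obtain B :: "'a set" where B: "finite B" "independent B" "span B = UNIV"
    using finite_dimensional_typeE[OF fd] by blast
  obtain m where m: "m > 0"
    "\<And>c. m * (\<Sum>b\<in>B. \<bar>c b\<bar>) \<le> norm (\<Sum>b\<in>B. c b *\<^sub>R b)"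
    using norm_linear_combination_ge[OF B(1,2)] by blast
  define H where "H = (\<Sum>b\<in>B. norm (h b))"
  have "norm (h x) \<le> norm x * (H / m)" for x
  proof -
    let ?r = "representation B x"
    have x: "(\<Sum>b\<in>B. ?r b *\<^sub>R b) = x"
      using B by (intro sum_representation_eq) auto
    have "h x = (\<Sum>b\<in>B. ?r b *\<^sub>R h b)"
      by (subst x[symmetric]) (simp add: linear_sum[OF h] linear_cmul[OF h])
    then have "norm (h x) \<le> (\<Sum>b\<in>B. \<bar>?r b\<bar> * norm (h b))"
      using norm_sum[of "\<lambda>b. ?r b *\<^sub>R h b" B] by simp
    also have "\<dots> \<le> (\<Sum>b\<in>B. \<bar>?r b\<bar> * H)"
      unfolding H_def using B(1)
      by (intro sum_mono mult_left_mono member_le_sum) auto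
    also have "\<dots> = (\<Sum>b\<in>B. \<bar>?r b\<bar>) * H" by (simp add: sum_distrib_right)
    also have "\<dots> \<le> (norm x / m) * H"
      using m(2)[of ?r] m(1) unfolding x
      by (intro mult_right_mono) (auto simp: field_simps H_def intro: sum_nonneg)
    finally show ?thesis by (simp add: field_simps)
  qed
  then show ?thesis
    using h by (intro bounded_linear_intro[where K = "H / m"]) (auto simp: linear_add linear_cmul)
qed

lemma exists_linear_functional_nonzero:
  fixes x :: "'a::real_vector"
  assumes "finite_dimensional_type TYPE('a)" "x \<noteq> 0"
  shows "\<exists>\<phi> :: 'a \<Rightarrow> real. linear \<phi> \<and> \<phi> x \<noteq> 0"
proof -
  have "independent {x}" using assms(2) by simp
  then obtain \<phi> :: "'a \<Rightarrow> real" where "linear \<phi>" "\<phi> x = 1"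
    using linear_independent_extend[of "{x}" "\<lambda>_. 1::real"] by auto
  then show ?thesis by (intro exI[of _ \<phi>]) auto
qed

section \<open>Joint eigenfunctionals of commuting multiplications\<close>

text \<open>The powers of \<open>a\<close> with exponents from 0 to the dimension are too many to be
  independent; the coefficients of a linear relation between them give the polynomial.\<close>

lemma exists_annihilating_polynomial:
  fixes a :: "'a::real_algebra_1"
  assumes fd: "finite_dimensional_type TYPE('a)"
  obtains P :: "real poly" where "P \<noteq> 0" "(\<Sum>k\<le>degree P. coeff P k *\<^sub>R a ^ k) = 0"
proof -
  obtain B :: "'a set" where B: "finite B" "independent B" "span B = UNIV"
    using finite_dimensional_typeE[OF fd] by blast
  have "\<exists>c. (\<exists>k\<le>card B. c k \<noteq> 0) \<and> (\<Sum>k\<le>card B. c k *\<^sub>R a ^ k) = 0"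
  proof (cases "inj_on (\<lambda>k. a ^ k) {..card B}")
    case True
    have "card ((\<lambda>k. a ^ k) ` {..card B}) = Suc (card B)"
      using True by (simp add: card_image)
    then have "dependent ((\<lambda>k. a ^ k) ` {..card B})"
      using independent_span_bound[OF B(1), of "(\<lambda>k. a ^ k) ` {..card B}"] B(3) by auto
    then obtain u where u: "\<exists>v\<in>(\<lambda>k. a ^ k) ` {..card B}. u v \<noteq> 0"
      "(\<Sum>v\<in>(\<lambda>k. a ^ k) ` {..card B}. u v *\<^sub>R v) = 0"
      by (subst (asm) dependent_finite) auto
    then show ?thesis
      by (intro exI[of _ "\<lambda>k. u (a ^ k)"]) (auto simp: sum.reindex[OF True])
  next
    \<comment> \<open>Dependence of a set does not see repetitions, so two coinciding powers are
      treated apart: the relation is then their difference.\<close>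
    case False
    then obtain i j where ij: "i \<le> card B" "j \<le> card B" "i \<noteq> j" "a ^ i = a ^ j"
      by (auto simp: inj_on_def)
    let ?c = "\<lambda>k. (if k = i then 1 else 0) - (if k = j then 1 else 0 :: real)"
    have "(\<Sum>k\<le>card B. ?c k *\<^sub>R a ^ k) = 0"
      using ij by (simp add: scaleR_left_diff_distrib sum_subtractf if_distrib[of "\<lambda>x. x *\<^sub>R _"] cong: if_cong)
    moreover have "?c i \<noteq> 0" using ij by simp
    ultimately show ?thesis using ij(1) by (intro exI[of _ ?c]) auto
  qed
  then obtain c where "(\<exists>k\<le>card B. c k \<noteq> 0) \<and> (\<Sum>k\<le>card B. c k *\<^sub>R a ^ k) = 0" ..
  then obtain k where c: "k \<le> card B" "c k \<noteq> 0" "(\<Sum>k\<le>card B. c k *\<^sub>R a ^ k) = 0"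
    by auto
  define P where "P = (\<Sum>k\<le>card B. monom (c k) k)"
  have co: "coeff P i = (if i \<le> card B then c i else 0)" for i
    by (simp add: P_def coeff_sum)
  have "P \<noteq> 0" using co[of k] c by auto
  moreover have "degree P \<le> card B" by (rule degree_le) (simp add: co)
  then have "(\<Sum>k\<le>degree P. coeff P k *\<^sub>R a ^ k) = (\<Sum>k\<le>card B. c k *\<^sub>R a ^ k)"
  proof (intro sum.mono_neutral_cong_left ballI)
    show "c i *\<^sub>R a ^ i = 0" if "i \<in> {..card B} - {..degree P}" for i
      using that co[of i] coeff_eq_0[of P i] by auto
  qed (auto simp: co)
  ultimately show ?thesis using that c by simp
qed

text \<open>Linear factors of \<open>P\<close> are split off one at a time. If \<open>z\<close> is a
  root and P = (X - z) Q, then either \<phi> already has eigenvalue \<open>z\<close> on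
  \<open>M\<close>, or m \<mapsto> \<phi>(a m) - z \<phi>(m) is nonzero on \<open>M\<close> and is
  annihilated by \<open>Q\<close>, which has smaller degree. The eigenvalues for \<open>F\<close>
  survive because \<open>a\<close> commutes with \<open>F\<close> and maps \<open>M\<close> into
  itself.\<close>

lemma exists_eigenfunctional_of_polynomial:
  fixes \<phi> :: "'a::real_algebra_1 \<Rightarrow> complex"
  assumes "P \<noteq> 0" "degree P \<le> n"
    and "\<And>m. m \<in> M \<Longrightarrow> (\<Sum>k\<le>n. coeff P k * \<phi> (a ^ k * m)) = 0"
    and "linear \<phi>" "\<exists>m\<in>M. \<phi> m \<noteq> 0"
    and "\<And>t. t \<in> F \<Longrightarrow> \<exists>c. \<forall>m\<in>M. \<phi> (t * m) = c * \<phi> m"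
    and inv: "\<And>m. m \<in> M \<Longrightarrow> a * m \<in> M"
    and comm: "\<And>t. t \<in> F \<Longrightarrow> a * t = t * a"
  shows "\<exists>\<psi> :: 'a \<Rightarrow> complex. linear \<psi> \<and> (\<exists>m\<in>M. \<psi> m \<noteq> 0) \<and>
    (\<forall>t\<in>insert a F. \<exists>c. \<forall>m\<in>M. \<psi> (t * m) = c * \<psi> m)"
  using assms(1-6)
proof (induction n arbitrary: P \<phi>)
  case 0
  then have "\<phi> m = 0" if "m \<in> M" for m
    using that leading_coeff_0_iff[of P] by fastforce
  with 0 show ?case by blast
next
  case (Suc n)
  show ?case
  proof (cases "degree P = 0")
    \<comment> \<open>A nonzero constant polynomial would force \<phi> to vanish on
      \<open>M\<close>, so this case is contradictory.\<close>
    case True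
    have "\<phi> m = 0" if "m \<in> M" for m
    proof -
      have "(\<Sum>k\<le>Suc n. coeff P k * \<phi> (a ^ k * m)) = (\<Sum>k\<in>{0}. coeff P k * \<phi> (a ^ k * m))"
        using True by (intro sum.mono_neutral_right) (auto simp: coeff_eq_0)
      with Suc.prems(3)[OF that] have "coeff P 0 * \<phi> m = 0" by simp
      moreover have "coeff P 0 \<noteq> 0" using True Suc.prems(1) leading_coeff_0_iff[of P] by simp
      ultimately show ?thesis by simp
    qed
    with Suc.prems show ?thesis by blast
  next
    case False
    then obtain z where "poly P z = 0"
      using fundamental_theorem_of_algebra[of P] unfolding constant_degree by blast
    then obtain Q where PQ: "P = [:-z, 1:] * Q"
      by (auto simp: poly_eq_0_iff_dvd elim: dvdE)
    with Suc.prems(1) have "Q \<noteq> 0" by auto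
    then have "degree P = Suc (degree Q)"
      unfolding PQ by (subst degree_mult_eq) auto
    with Suc.prems(2) have dQ: "degree Q \<le> n" by simp
    define \<psi> where "\<psi> m = \<phi> (a * m) - z * \<phi> m" for m
    have lin: "linear \<psi>"
      unfolding \<psi>_def using Suc.prems(4)
      by (intro linearI) (simp_all add: linear_add linear_cmul algebra_simps)
    have eig: "\<exists>c. \<forall>m\<in>M. \<psi> (t * m) = c * \<psi> m" if "t \<in> F" for t
    proof -
      obtain c where c: "\<And>m. m \<in> M \<Longrightarrow> \<phi> (t * m) = c * \<phi> m"
        using Suc.prems(6)[OF \<open>t \<in> F\<close>] by blast
      have "\<phi> (a * (t * m)) = c * \<phi> (a * m)" if "m \<in> M" for m
        using c[OF inv[OF that]] comm[OF \<open>t \<in> F\<close>] by (simp flip: mult.assoc)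
      with c show ?thesis by (intro exI[of _ c]) (simp add: \<psi>_def algebra_simps)
    qed
    have "(\<Sum>k\<le>n. coeff Q k * \<psi> (a ^ k * m)) = 0" if "m \<in> M" for m
    proof -
      have "(\<Sum>k\<le>n. coeff Q k * \<psi> (a ^ k * m)) =
          (\<Sum>k\<le>n. coeff Q k * \<phi> (a ^ Suc k * m)) - z * (\<Sum>k\<le>n. coeff Q k * \<phi> (a ^ k * m))"
        by (simp add: \<psi>_def sum_subtractf sum_distrib_left algebra_simps)
      also have "(\<Sum>k\<le>n. coeff Q k * \<phi> (a ^ Suc k * m)) =
          (\<Sum>k\<le>Suc n. coeff (pCons 0 Q) k * \<phi> (a ^ k * m))"
        by (subst sum.atMost_Suc_shift) simp
      \<comment> \<open>The added top term is 0 because \<open>degree Q \<le> n\<close>. Both sums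
        now have the same range and combine to the coefficients of X Q - z Q = P.\<close>
      also have "(\<Sum>k\<le>n. coeff Q k * \<phi> (a ^ k * m)) = (\<Sum>k\<le>Suc n. coeff Q k * \<phi> (a ^ k * m))"
        using dQ by (simp add: coeff_eq_0)
      also have "(\<Sum>k\<le>Suc n. coeff (pCons 0 Q) k * \<phi> (a ^ k * m)) -
          z * (\<Sum>k\<le>Suc n. coeff Q k * \<phi> (a ^ k * m)) =
          (\<Sum>k\<le>Suc n. coeff P k * \<phi> (a ^ k * m))"
        unfolding sum_distrib_left sum_subtractf[symmetric]
        by (intro sum.cong) (auto simp: PQ algebra_simps)
      finally show ?thesis using Suc.prems(3)[OF that] by simp
    qed
    note IH = Suc.IH[OF \<open>Q \<noteq> 0\<close> dQ this lin _ eig]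
    show ?thesis
    proof (cases "\<exists>m\<in>M. \<psi> m \<noteq> 0")
      case True
      then show ?thesis using IH by blast
    next
      case False
      then have "\<forall>m\<in>M. \<phi> (a * m) = z * \<phi> m" by (simp add: \<psi>_def)
      with Suc.prems show ?thesis by blast
    qed
  qed
qed

text \<open>The multiplications are adjoined one by one; the previous lemma replaces the functional
  by one that is also an eigenfunctional for the new element and still one for the old elements. The
  annihilating polynomial is real and is read over the complex numbers to have roots.\<close>

lemma exists_joint_eigenfunctional:
  fixes \<phi> :: "'a::real_algebra_1 \<Rightarrow> complex"
  assumes fd: "finite_dimensional_type TYPE('a)" and "finite F"
    and "linear \<phi>" "\<exists>m\<in>M. \<phi> m \<noteq> 0"
    and "\<And>t m. t \<in> F \<Longrightarrow> m \<in> M \<Longrightarrow> t * m \<in> M"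
    and "\<And>t u. t \<in> F \<Longrightarrow> u \<in> F \<Longrightarrow> t * u = u * t"
  shows "\<exists>\<psi> :: 'a \<Rightarrow> complex. linear \<psi> \<and> (\<exists>m\<in>M. \<psi> m \<noteq> 0) \<and>
    (\<forall>t\<in>F. \<exists>c. \<forall>m\<in>M. \<psi> (t * m) = c * \<psi> m)"
  using assms(2-)
proof (induction F rule: finite_induct)
  case empty
  then show ?case by blast
next
  case (insert a F)
  have "\<exists>\<psi> :: 'a \<Rightarrow> complex. linear \<psi> \<and> (\<exists>m\<in>M. \<psi> m \<noteq> 0) \<and>
      (\<forall>t\<in>F. \<exists>c. \<forall>m\<in>M. \<psi> (t * m) = c * \<psi> m)"
    using insert.prems by (intro insert.IH) auto
  then obtain \<psi> :: "'a \<Rightarrow> complex" where \<psi>: "linear \<psi>" "\<exists>m\<in>M. \<psi> m \<noteq> 0"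
    "\<forall>t\<in>F. \<exists>c. \<forall>m\<in>M. \<psi> (t * m) = c * \<psi> m"
    by blast
  obtain P :: "real poly" where P: "P \<noteq> 0" "(\<Sum>k\<le>degree P. coeff P k *\<^sub>R a ^ k) = 0"
    using exists_annihilating_polynomial[OF fd] by blast
  let ?P = "map_poly complex_of_real P"
  have "(\<Sum>k\<le>degree P. coeff ?P k * \<psi> (a ^ k * m)) = 0" for m
  proof -
    have "(\<Sum>k\<le>degree P. coeff ?P k * \<psi> (a ^ k * m)) =
        \<psi> ((\<Sum>k\<le>degree P. coeff P k *\<^sub>R a ^ k) * m)"
      by (simp add: sum_distrib_right linear_sum[OF \<psi>(1)] linear_cmul[OF \<psi>(1)]
          coeff_map_poly scaleR_conv_of_real[where 'a = complex])
    then show ?thesis using P(2) linear_0[OF \<psi>(1)] by simp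
  qed
  moreover have "?P \<noteq> 0" using P(1) by (simp add: map_poly_eq_0_iff)
  moreover have "degree ?P \<le> degree P" by (simp add: degree_map_poly)
  ultimately show ?case
    using insert.prems \<psi>
    by (intro exists_eigenfunctional_of_polynomial[where P = ?P and n = "degree P" and \<phi> = \<psi>]) auto
qed


section \<open>Invariance of a bounded function along one block of coordinates\<close>

text \<open>Closure under left multiplication by \<open>A\<close>, without sums, is the invariance
  that the eigenfunctional lemmas ask for. Rule induction then carries the vanishing of an
  eigenfunctional from \<open>D\<close> to the whole orbit.\<close>

inductive_set orbit :: "'a::times set \<Rightarrow> 'a set \<Rightarrow> 'a set" for A D where
  base: "d \<in> D \<Longrightarrow> d \<in> orbit A D"
| step: "a \<in> A \<Longrightarrow> m \<in> orbit A D \<Longrightarrow> a * m \<in> orbit A D"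

text \<open>Differentiability relative to \<open>S\<close> becomes unrestricted differentiability in
  the parameter, because the affine map x + \<gamma> z never leaves \<open>S\<close>.\<close>

lemma has_derivative_along_linear:
  fixes f :: "'x::real_normed_vector \<Rightarrow> 'y::real_normed_vector"
  assumes D: "(f has_derivative D) (at (x + \<gamma> z) within S)"
    and S: "subspace S" and x: "x \<in> S" and \<gamma>: "bounded_linear \<gamma>" "\<And>z. \<gamma> z \<in> S"
  shows "((\<lambda>z. f (x + \<gamma> z)) has_derivative (\<lambda>h. D (\<gamma> h))) (at z)"
proof (rule has_derivative_in_compose[where g = f and f = "\<lambda>z. x + \<gamma> z"])
  show "((\<lambda>z. x + \<gamma> z) has_derivative \<gamma>) (at z)"
    using has_derivative_add[OF has_derivative_const[of x] bounded_linear_imp_has_derivative[OF \<gamma>(1)]]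
    by simp
  show "(f has_derivative D) (at (x + \<gamma> z) within range (\<lambda>z. x + \<gamma> z))"
    using D by (rule has_derivative_subset) (use S x \<gamma>(2) in \<open>auto intro: subspace_add\<close>)
qed

text \<open>
  For a non-real \<open>c\<close>, the equation \<open>D\<^sub>w u = c D\<^sub>v u\<close> is the Cauchy--Riemann equation
  in the coordinate \<open>z\<close> that identifies \<open>z = \<alpha> + \<beta> c\<close> with \<open>\<alpha> v + \<beta> w\<close>.
\<close>
lemma Liouville_nonreal_direction:
  fixes u :: "'x::real_normed_vector \<Rightarrow> complex"
  assumes S: "subspace S" and D: "\<And>x. x \<in> S \<Longrightarrow> (u has_derivative D x) (at x within S)"
    and vw: "v \<in> S" "w \<in> S" and c: "Im c \<noteq> 0"
    and CR: "\<And>x. x \<in> S \<Longrightarrow> D x w = c * D x v"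
    and bd: "bounded (u ` S)" and x: "x \<in> S"
  shows "D x v = 0"
proof -
  define \<beta> where "\<beta> = (\<lambda>z. Im z / Im c)"
  define \<alpha> where "\<alpha> = (\<lambda>z. Re z - Re c * \<beta> z)"
  define \<gamma> where "\<gamma> = (\<lambda>z. \<alpha> z *\<^sub>R v + \<beta> z *\<^sub>R w)"
  have z: "of_real (\<alpha> z) + c * of_real (\<beta> z) = z" for z
    using c by (simp add: complex_eq_iff \<alpha>_def \<beta>_def)
  have "bounded_linear \<beta>"
    unfolding \<beta>_def divide_inverse by (intro bounded_linear_mult_const bounded_linear_Im)
  then have "bounded_linear \<gamma>"
    unfolding \<gamma>_def \<alpha>_def
    by (intro bounded_linear_add bounded_linear_scaleR_const bounded_linear_sub
        bounded_linear_Re bounded_linear_const_mult)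
  moreover have \<gamma>S: "\<gamma> z \<in> S" for z
    unfolding \<gamma>_def using S vw by (intro subspace_add subspace_scale)
  ultimately have der: "((\<lambda>z. u (x + \<gamma> z)) has_derivative (\<lambda>h. D (x + \<gamma> z) (\<gamma> h))) (at z)" for z
    by (intro has_derivative_along_linear[OF D S x]) (auto intro: subspace_add[OF S x])
  have D\<gamma>: "D y (\<gamma> h) = D y v * h" if y: "y \<in> S" for y h
  proof -
    have lin: "linear (D y)"
      using D[OF y] has_derivative_bounded_linear bounded_linear.linear by blast
    have "D y (\<gamma> h) = (of_real (\<alpha> h) + c * of_real (\<beta> h)) * D y v"
      unfolding \<gamma>_def by (simp add: linear_add[OF lin] linear_cmul[OF lin] CR[OF y]
          scaleR_conv_of_real algebra_simps)
    then show ?thesis by (simp add: z)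
  qed
  have fd: "((\<lambda>z. u (x + \<gamma> z)) has_field_derivative D (x + \<gamma> z) v) (at z)" for z
    unfolding has_field_derivative_def
    using der[of z] by (simp add: D\<gamma>[OF subspace_add[OF S x \<gamma>S]])
  then have "(\<lambda>z. u (x + \<gamma> z)) holomorphic_on UNIV"
    by (auto simp: holomorphic_on_def field_differentiable_def intro: has_field_derivative_at_within)
  moreover have "bounded (range (\<lambda>z. u (x + \<gamma> z)))"
    by (rule bounded_subset[OF bd]) (auto intro: subspace_add[OF S x] \<gamma>S)
  ultimately obtain k where "\<And>z. u (x + \<gamma> z) = k"
    using Liouville_theorem unfolding constant_on_def by blast
  then have "((\<lambda>z. u (x + \<gamma> z)) has_field_derivative 0) (at 0)" by simp
  then have "D (x + \<gamma> 0) v = 0" using fd[of 0] DERIV_unique by blast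
  moreover have "\<gamma> 0 = 0" by (simp add: \<gamma>_def \<alpha>_def \<beta>_def)
  ultimately show ?thesis by simp
qed

text \<open>One statement serves both kinds of variables: for an even one \<open>T\<close> is
  \<open>{0..p}\<close> with a = e and \<tau> = 0, for an odd one \<open>T\<close> is a block of
  indices and \<tau> its first index \<open>s k\<close>.\<close>

lemma invariant_along_null_directions:
  fixes f :: "'x::real_normed_vector \<Rightarrow> 'a::{real_normed_vector, real_algebra_1}"
  assumes fd: "finite_dimensional_type TYPE('a)" and S: "subspace S" and T: "finite T"
    and v: "\<And>t. t \<in> T \<Longrightarrow> v t \<in> S" and \<tau>: "\<tau> \<in> T" "a \<tau> = 1"
    and comm: "\<And>t u. t \<in> T \<Longrightarrow> u \<in> T \<Longrightarrow> a t * a u = a u * a t"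
    and null: "(\<Sum>t\<in>T. (a t)\<^sup>2) = 0"
    and diff: "\<And>x. x \<in> S \<Longrightarrow> f differentiable (at x within S)"
    and bd: "bounded (f ` S)"
    and CR: "\<And>x t. x \<in> S \<Longrightarrow> t \<in> T \<Longrightarrow> vector_derivative (\<lambda>h. f (x + h *\<^sub>R v t)) (at 0) =
               a t * vector_derivative (\<lambda>h. f (x + h *\<^sub>R v \<tau>)) (at 0)"
    and x: "x \<in> S" and t: "t \<in> T"
  shows "f (x + c *\<^sub>R v t) = f x"
proof -
  obtain D where D: "\<And>x. x \<in> S \<Longrightarrow> (f has_derivative D x) (at x within S)"
    using diff unfolding differentiable_def by metis
  have dir: "((\<lambda>h. f (x + h *\<^sub>R w)) has_vector_derivative D (x + h *\<^sub>R w) w) (at h)"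
    if "x \<in> S" "w \<in> S" for x w h
  proof -
    have in_S: "x + h *\<^sub>R w \<in> S" using S that by (intro subspace_add subspace_scale)
    then have "linear (D (x + h *\<^sub>R w))"
      using D has_derivative_bounded_linear bounded_linear.linear by blast
    moreover have "((\<lambda>h. f (x + h *\<^sub>R w)) has_derivative (\<lambda>k. D (x + h *\<^sub>R w) (k *\<^sub>R w))) (at h)"
      using that S by (intro has_derivative_along_linear[where \<gamma> = "\<lambda>k. k *\<^sub>R w", OF D[OF in_S] S])
        (auto intro: bounded_linear_scaleR_left subspace_scale)
    ultimately show ?thesis
      by (simp add: has_vector_derivative_def linear_cmul)
  qed
  \<comment> \<open>This is the derivative in the reference direction, where the coefficient is 1;
    the derivative along \<open>v t\<close> is \<open>a t * G x\<close>, so it suffices that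
    \<open>G\<close> vanishes on \<open>S\<close>.\<close>
  define G where "G x = D x (v \<tau>)" for x
  have Dv: "D x (v t) = a t * G x" if "x \<in> S" "t \<in> T" for x t
    using CR[OF that] vector_derivative_at[OF dir[OF that(1) v[OF that(2)], of 0]]
      vector_derivative_at[OF dir[OF that(1) v[OF \<tau>(1)], of 0]]
    by (simp add: G_def)
  define M where "M = orbit (a ` T) (G ` S)"
  have GM: "G y \<in> M" if "y \<in> S" for y
    unfolding M_def using that by (auto intro: orbit.base)
  have aM: "a t * m \<in> M" if "t \<in> T" "m \<in> M" for t m
    using that unfolding M_def by (auto intro: orbit.step)
  have "G y = 0" if y: "y \<in> S" for y
  proof (rule ccontr)
    assume "G y \<noteq> 0"
    then obtain \<phi> :: "'a \<Rightarrow> real" where "linear \<phi>" "\<phi> (G y) \<noteq> 0"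
      using exists_linear_functional_nonzero[OF fd] by blast
    \<comment> \<open>The real functional is regarded as complex-valued, since the eigenvalues
      obtained from it need not be real.\<close>
    then have \<phi>: "linear (\<lambda>m. complex_of_real (\<phi> m))" "complex_of_real (\<phi> (G y)) \<noteq> 0"
      by (auto intro!: linearI simp: linear_add linear_cmul simp flip: scaleR_conv_of_real)
    have "\<exists>\<psi> :: 'a \<Rightarrow> complex. linear \<psi> \<and> (\<exists>m\<in>M. \<psi> m \<noteq> 0) \<and>
        (\<forall>t\<in>a ` T. \<exists>c. \<forall>m\<in>M. \<psi> (t * m) = c * \<psi> m)"
      by (rule exists_joint_eigenfunctional[OF fd _ \<phi>(1)])
        (use T \<phi>(2) GM[OF y] comm aM in auto)
    then obtain \<psi> m1 where \<psi>: "linear \<psi>" "m1 \<in> M" "\<psi> m1 \<noteq> (0::complex)"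
      and "\<forall>t\<in>T. \<exists>c. \<forall>m\<in>M. \<psi> (a t * m) = c * \<psi> m"
      by auto
    from bchoice[OF this(4)] obtain c
      where "\<forall>t\<in>T. \<forall>m\<in>M. \<psi> (a t * m) = c t * \<psi> m" ..
    then have c: "\<And>t m. t \<in> T \<Longrightarrow> m \<in> M \<Longrightarrow> \<psi> (a t * m) = c t * \<psi> m"
      by blast
    \<comment> \<open>The eigenvalue relation is used twice for each \<open>t\<close>, the first
      time at \<open>a t * m1\<close>, which again lies in \<open>M\<close>.\<close>
    have "(\<Sum>t\<in>T. (c t)\<^sup>2) * \<psi> m1 = \<psi> ((\<Sum>t\<in>T. (a t)\<^sup>2) * m1)"
      unfolding sum_distrib_right linear_sum[OF \<psi>(1)]
      by (intro sum.cong) (auto simp: power2_eq_square c aM \<psi> mult.assoc)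
    then have sum0: "(\<Sum>t\<in>T. (c t)\<^sup>2) = 0"
      using null \<psi> linear_0[OF \<psi>(1)] by simp
    have "c \<tau> = 1" using c[OF \<tau>(1) \<psi>(2)] \<tau>(2) \<psi>(3) by simp
    have "\<exists>t\<in>T. Im (c t) \<noteq> 0"
    proof (rule ccontr)
      assume "\<not> ?thesis"
      then have "(\<Sum>t\<in>T. (Re (c t))\<^sup>2) = Re (\<Sum>t\<in>T. (c t)\<^sup>2)"
        by (simp add: power2_eq_square)
      then have "(\<Sum>t\<in>T. (Re (c t))\<^sup>2) = 0" using sum0 by simp
      then have "\<forall>t\<in>T. (Re (c t))\<^sup>2 = 0"
        using T by (subst (asm) sum_nonneg_eq_0_iff) auto
      with \<open>c \<tau> = 1\<close> \<tau>(1) show False by force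
    qed
    then obtain t1 where t1: "t1 \<in> T" "Im (c t1) \<noteq> 0" by blast
    have bl: "bounded_linear \<psi>" by (rule linear_imp_bounded_linear[OF fd \<psi>(1)])
    have \<psi>G: "\<psi> (G z) = 0" if z: "z \<in> S" for z
      unfolding G_def
    proof (rule Liouville_nonreal_direction[OF S _ v[OF \<tau>(1)] v[OF t1(1)] t1(2) _ _ z])
      show "((\<lambda>x. \<psi> (f x)) has_derivative (\<lambda>h. \<psi> (D x h))) (at x within S)" if "x \<in> S" for x
        by (rule bounded_linear.has_derivative[OF bl D[OF that]])
      show "\<psi> (D x (v t1)) = c t1 * \<psi> (D x (v \<tau>))" if "x \<in> S" for x
        using Dv[OF that t1(1)] c[OF t1(1) GM[OF that]] by (simp add: G_def)
      show "bounded ((\<lambda>x. \<psi> (f x)) ` S)"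
        using bounded_linear_image[OF bd bl] by (simp add: image_image)
    qed
    \<comment> \<open>Each multiplication by some \<open>a t\<close> only scales \<psi> by
      \<open>c t\<close>, so vanishing on the values of \<open>G\<close> spreads to all of
      \<open>M\<close> and contradicts the choice of \<open>m1\<close>.\<close>
    have "\<psi> m = 0" if "m \<in> M" for m
      using that unfolding M_def
    proof (induction m rule: orbit.induct)
      case (base d)
      then show ?case using \<psi>G by blast
    next
      case (step b m)
      then show ?case using c by (auto simp: M_def)
    qed
    with \<psi> show False by blast
  qed
  then have "((\<lambda>h. f (x + h *\<^sub>R v t)) has_vector_derivative 0) (at h)" for h
    using dir[OF x v[OF t], of h] Dv[OF _ t, of "x + h *\<^sub>R v t"] S x v[OF t]
    by (simp add: subspace_add subspace_scale)
  then obtain k where "\<And>h. f (x + h *\<^sub>R v t) = k"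
    using has_vector_derivative_zero_constant[of UNIV "\<lambda>h. f (x + h *\<^sub>R v t)"] by auto
  from this[of c] this[of 0] show ?thesis by simp
qed


section \<open>Coordinates on the superspace and coefficients of d''\<close>

text \<open>The preimage of \<open>W\<close> under \<open>L\<close> is a subspace containing the
  basis, hence all of \<open>V\<close>. It later turns periods along basis vectors into periods
  along every vector of \<Lambda>_0 or \<Lambda>_1.\<close>

lemma basis_family_image_subset:
  assumes "basis_family b K V" "linear L" "subspace W" "\<And>k. k \<in> K \<Longrightarrow> L (b k) \<in> W" "x \<in> V"
  shows "L x \<in> W"
proof -
  have "span (b ` K) \<subseteq> L -` W"
    using assms by (intro span_minimal linear_subspace_vimage) auto
  with assms show ?thesis unfolding basis_family_def by blast
qed

lemma superspace_iff:
  "(y, \<theta>) \<in> superspace \<Lambda> I J \<longleftrightarrow>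
     (\<forall>i\<in>I. y $ i \<in> \<Lambda> 0) \<and> (\<forall>i. i \<notin> I \<longrightarrow> y $ i = 0) \<and>
     (\<forall>i\<in>J. \<theta> $ i \<in> \<Lambda> 1) \<and> (\<forall>i. i \<notin> J \<longrightarrow> \<theta> $ i = 0)"
  by (simp add: superspace_def)

lemma subspace_superspace:
  assumes "subspace (\<Lambda> 0)" "subspace (\<Lambda> 1)"
  shows "subspace (superspace \<Lambda> I J)"
  using assms unfolding subspace_def
  by (auto simp: superspace_iff zero_prod_def)

lemma axis_in_superspace:
  assumes "subspace (\<Lambda> 0)" "subspace (\<Lambda> 1)"
  shows "i \<in> I \<Longrightarrow> b \<in> \<Lambda> 0 \<Longrightarrow> (axis i b, 0) \<in> superspace \<Lambda> I J"
    and "i' \<in> J \<Longrightarrow> b \<in> \<Lambda> 1 \<Longrightarrow> (0, axis i' b) \<in> superspace \<Lambda> I J"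
  using assms by (auto simp: superspace_iff axis_def subspace_0)

lemma representation_basis_family:
  assumes b: "basis_family b K V" and i: "i \<in> K" and j: "j \<in> K"
  shows "representation (b ` K) (b i) (b j) = (if i = j then 1 else 0)"
proof -
  have "representation (b ` K) (b i) = (\<lambda>v. if v = b i then 1 else 0)"
    using b i unfolding basis_family_def by (intro representation_basis) auto
  moreover have "b j = b i \<longleftrightarrow> i = j"
    using b i j unfolding basis_family_def by (metis inj_onD)
  ultimately show ?thesis by simp
qed

lemma basis_family_mem: "basis_family b K V \<Longrightarrow> k \<in> K \<Longrightarrow> b k \<in> V"
  unfolding basis_family_def using span_base[of "b k" "b ` K"] by simp

text \<open>The largest \<open>k\<close> in \<open>{1..r}\<close> with \<open>s k \<le> j\<close>
  works: if also \<open>s (k + 1) \<le> j\<close>, then k + 1 is still at most r, since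
  \<open>s (r + 1)\<close> exceeds \<open>j\<close>, and maximality fails.\<close>

lemma exists_block:
  fixes s :: "nat \<Rightarrow> nat"
  assumes s: "s 1 = 1" "s (r + 1) = q + 1" and j: "j \<in> {1..q}"
  shows "\<exists>k\<in>{1..r}. s k \<le> j \<and> j < s (k + 1)"
proof -
  let ?K = "{k \<in> {1..r}. s k \<le> j}"
  have "r \<noteq> 0" using s j by (intro notI) simp
  then have "1 \<in> ?K" using s j by simp
  then have "finite ?K" "?K \<noteq> {}" by auto
  then obtain k where k: "k \<in> ?K" and max: "\<And>i. i \<in> ?K \<Longrightarrow> i \<le> k"
    using Max_in[of ?K] Max_ge[of ?K] by blast
  have "j < s (k + 1)"
  proof (rule ccontr)
    assume *: "\<not> j < s (k + 1)"
    then have "k \<noteq> r" using s j by auto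
    with * k have "k + 1 \<in> ?K" by simp
    then have "k + 1 \<le> k" by (rule max)
    then show False by simp
  qed
  with k show ?thesis by blast
qed

text \<open>If one block index is smaller than the other, monotonicity of \<open>s\<close> puts the
  end of its block no later than the start of the other block.\<close>

lemma block_unique:
  fixes s :: "nat \<Rightarrow> nat"
  assumes s: "strict_mono_on {1..r+1} s" and k: "k \<in> {1..r}" "k' \<in> {1..r}"
    and j: "s k \<le> j" "j < s (k + 1)" "s k' \<le> j" "j < s (k' + 1)"
  shows "k = k'"
proof -
  have mono: "s i \<le> s i'" if "i \<le> i'" "i \<in> {1..r+1}" "i' \<in> {1..r+1}" for i i'
    using strict_mono_onD[OF s, of i i'] that by (cases "i = i'") auto
  show ?thesis
    using mono[of "k + 1" k'] mono[of "k' + 1" k] k j by (cases k k' rule: linorder_cases) auto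
qed

lemma sum_eq_single:
  assumes "finite A" "x \<in> A" "\<And>y. y \<in> A \<Longrightarrow> y \<noteq> x \<Longrightarrow> g y = 0"
  shows "sum g A = g x"
proof -
  have "sum g A = sum g {x}" using assms by (intro sum.mono_neutral_right) auto
  then show ?thesis by simp
qed

text \<open>The coordinate differentials are dual to the basis, so evaluating on a basis vector
  isolates one coefficient of the form. The index starts at 1 because the differential of the
  coordinate at \<open>e 0\<close> does not occur in d''.\<close>

lemma d''_form_even_basis:
  fixes f :: "('a ^ 'n) \<times> ('a ^ 'm) \<Rightarrow> 'a::{real_normed_vector, real_algebra_1}"
  assumes e: "basis_family e {0..p} (\<Lambda> 0)" and i: "i \<in> I" and j: "j \<in> {1..p}"
  shows "d''_form p e q \<epsilon> r s a I J f x (axis i (e j), 0) =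
    partial_even f i (e j) x - e j * partial_even f i (e 0) x"
proof -
  define G where "G i' j' = representation (e ` {0..p}) (axis i (e j) $ i') (e j') *\<^sub>R
    (partial_even f i' (e j') x - e j' * partial_even f i' (e 0) x)" for i' j'
  have G0: "G i' j' = 0" if "i' \<noteq> i" for i' j'
    using that by (simp add: G_def axis_def representation_zero)
  have G1: "G i j' = 0" if "j' \<in> {1..p}" "j' \<noteq> j" for j'
    using that j by (simp add: G_def representation_basis_family[OF e])
  have G: "G i j = partial_even f i (e j) x - e j * partial_even f i (e 0) x"
    using j by (simp add: G_def representation_basis_family[OF e])
  have "d''_form p e q \<epsilon> r s a I J f x (axis i (e j), 0) = (\<Sum>i'\<in>I. \<Sum>j'=1..p. G i' j')"
    by (simp add: d''_form_def G_def representation_zero)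
  also have "\<dots> = (\<Sum>j'=1..p. G i j')"
    by (rule sum_eq_single[OF _ i]) (simp_all add: G0)
  also have "\<dots> = G i j"
    by (rule sum_eq_single[OF _ j]) (simp_all add: G1)
  finally show ?thesis using G by (rule trans)
qed

text \<open>As in the even case, but the sum over blocks must also collapse; this rests on each
  index belonging to a single block.\<close>

lemma d''_form_odd_basis:
  fixes f :: "('a ^ 'n) \<times> ('a ^ 'm) \<Rightarrow> 'a::{real_normed_vector, real_algebra_1}"
  assumes eps: "basis_family \<epsilon> {1..q} (\<Lambda> 1)" and i: "i \<in> J" and k: "k \<in> {1..r}"
    and t: "t \<in> {s k + 1..s (k + 1) - 1}"
    and s: "strict_mono_on {1..r+1} s" "s 1 = 1" "s (r + 1) = q + 1"
  shows "d''_form p e q \<epsilon> r s a I J f x (0, axis i (\<epsilon> t)) =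
    partial_odd f i (\<epsilon> t) x - a t * partial_odd f i (\<epsilon> (s k)) x"
proof -
  let ?B = "\<lambda>k. {s k + 1..s (k + 1) - 1}"
  define G where "G i' l t' = representation (\<epsilon> ` {1..q}) (axis i (\<epsilon> t) $ i') (\<epsilon> t') *\<^sub>R
    (partial_odd f i' (\<epsilon> t') x - a t' * partial_odd f i' (\<epsilon> (s l)) x)" for i' l t'
  have mono: "s i \<le> s i'" if "i \<le> i'" "i \<in> {1..r+1}" "i' \<in> {1..r+1}" for i i'
    using strict_mono_onD[OF s(1), of i i'] that by (cases "i = i'") auto
  have B: "t' \<in> {1..q}" if "l \<in> {1..r}" "t' \<in> ?B l" for l t'
    using mono[of 1 l] mono[of "l + 1" "r + 1"] s that by auto
  note tq = B[OF k t]
  have G0: "G i' l t' = 0" if "i' \<noteq> i" for i' l t'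
    using that by (simp add: G_def axis_def representation_zero)
  have G1: "G i l t' = 0" if "l \<in> {1..r}" "t' \<in> ?B l" "t' \<noteq> t" for l t'
    unfolding G_def axis_nth representation_basis_family[OF eps tq B[OF that(1,2)]]
    using that(3) by simp
  have G2: "G i l t' = 0" if l: "l \<in> {1..r}" "l \<noteq> k" and t': "t' \<in> ?B l" for l t'
  proof (rule G1[OF l(1) t'])
    show "t' \<noteq> t"
    proof
      assume "t' = t"
      with t t' have "t < s (k + 1)" "t < s (l + 1)" "s k \<le> t" "s l \<le> t"
        unfolding atLeastAtMost_iff by linarith+
      then show False
        using block_unique[OF s(1) l(1) k, of t] l(2) by simp
    qed
  qed
  have G: "G i k t = partial_odd f i (\<epsilon> t) x - a t * partial_odd f i (\<epsilon> (s k)) x"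
    unfolding G_def axis_nth representation_basis_family[OF eps tq tq] by simp
  have "d''_form p e q \<epsilon> r s a I J f x (0, axis i (\<epsilon> t)) =
      (\<Sum>i'\<in>J. \<Sum>l=1..r. \<Sum>t'\<in>?B l. G i' l t')"
    by (simp add: d''_form_def G_def representation_zero)
  also have "\<dots> = (\<Sum>l=1..r. \<Sum>t'\<in>?B l. G i l t')"
    by (rule sum_eq_single[OF _ i]) (simp_all add: G0)
  also have "\<dots> = (\<Sum>t'\<in>?B k. G i k t')"
    by (rule sum_eq_single[OF _ k]) (simp, rule sum.neutral, blast intro: G2)
  also have "\<dots> = G i k t"
    by (rule sum_eq_single[OF _ t]) (simp, rule G1[OF k])
  finally show ?thesis using G by (rule trans)
qed

text \<open>Sums of periods are periods because the intermediate point x + c w stays in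
  \<open>S\<close>. Quantifying over all multiples \<open>c\<close> makes closure under scaling
  immediate.\<close>

lemma subspace_periods:
  fixes f :: "'x::real_vector \<Rightarrow> 'y"
  assumes S: "subspace S"
  shows "subspace {w. \<forall>c. c *\<^sub>R w \<in> S \<and> (\<forall>x\<in>S. f (x + c *\<^sub>R w) = f x)}" (is "subspace ?P")
proof (rule subspaceI)
  show "0 \<in> ?P" by (simp add: subspace_0[OF S])
  show "c *\<^sub>R w \<in> ?P" if "w \<in> ?P" for c w using that by simp
  show "w + w' \<in> ?P" if w: "w \<in> ?P" "w' \<in> ?P" for w w'
  proof -
    have "f (x + (c *\<^sub>R w + c *\<^sub>R w')) = f x" if "x \<in> S" for x c
    proof -
      have "f (x + c *\<^sub>R w + c *\<^sub>R w') = f (x + c *\<^sub>R w)"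
        using w that by (simp add: subspace_add[OF S])
      also have "\<dots> = f x" using w that by simp
      finally show ?thesis by (simp add: add.assoc)
    qed
    with w show ?thesis by (simp add: scaleR_add_right subspace_add[OF S])
  qed
qed

lemma axis_decomposition:
  fixes y :: "'a::real_vector ^ 'n" and \<theta> :: "'a ^ 'm"
  assumes "\<And>i. i \<notin> I \<Longrightarrow> y $ i = 0" "\<And>i. i \<notin> J \<Longrightarrow> \<theta> $ i = 0"
  shows "(\<Sum>i\<in>I. (axis i (y $ i), 0)) + (\<Sum>i\<in>J. (0, axis i (\<theta> $ i))) = (y, \<theta>)"
  using assms
  by (intro prod_eqI) (auto simp: fst_sum snd_sum vec_eq_iff axis_def sum.delta' cong: if_cong)

lemma linear_axis:
  "linear (\<lambda>b::'a::real_vector. (axis i b :: 'a ^ 'n, 0 :: 'b::real_vector))"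
  "linear (\<lambda>b::'a::real_vector. (0 :: 'b::real_vector, axis i b :: 'a ^ 'n))"
  by (auto intro!: linearI simp: vec_eq_iff axis_def)

section \<open>Every vector of the superspace is a period of the function\<close>

theorem mainTheorem8:
  fixes \<Lambda> :: "nat \<Rightarrow> 'a::{real_normed_vector, real_algebra_1} set"
    and e \<epsilon> a :: "nat \<Rightarrow> 'a" and s :: "nat \<Rightarrow> nat" and p q r :: nat
    and I :: "'n::finite set" and J :: "'m::finite set"
    and f :: "('a ^ 'n) \<times> ('a ^ 'm) \<Rightarrow> 'a"
  assumes "commutative_superalgebra \<Lambda>"
    and "finite_dimensional_type TYPE('a)"
    and "condition_A0 \<Lambda> p e"
    and "condition_A1 \<Lambda> q \<epsilon> r s a"
    and "qS_differentiable_on \<Lambda> p e q \<epsilon> r s a I J f (superspace \<Lambda> I J)"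
    and "bounded (f ` superspace \<Lambda> I J)"
  shows "f constant_on superspace \<Lambda> I J"
proof -
  define S where "S = superspace \<Lambda> I J"
  have sub: "subspace (\<Lambda> 0)" "subspace (\<Lambda> 1)"
    using assms(1) unfolding commutative_superalgebra_def by auto
  have S: "subspace S" unfolding S_def using sub by (rule subspace_superspace)
  have "\<forall>x\<in>\<Lambda> 0. \<forall>y\<in>\<Lambda> 0. x * y = (-1) ^ (0 * 0) * (y * x)"
    using assms(1) unfolding commutative_superalgebra_def by blast
  then have comm: "x * y = y * x" if "x \<in> \<Lambda> 0" "y \<in> \<Lambda> 0" for x y
    using that by simp
  have e: "basis_family e {0..p} (\<Lambda> 0)" "e 0 = 1" "(\<Sum>k=0..p. (e k)\<^sup>2) = 0"
    using assms(3) unfolding condition_A0_def by auto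
  have eps: "basis_family \<epsilon> {1..q} (\<Lambda> 1)"
    and s: "s 1 = 1" "s (r + 1) = q + 1" "strict_mono_on {1..r+1} s"
    and a: "\<And>j. j \<in> {1..q} \<Longrightarrow> a j \<in> \<Lambda> 0" "\<And>k. k \<in> {1..r} \<Longrightarrow> a (s k) = 1"
      "\<And>k. k \<in> {1..r} \<Longrightarrow> (\<Sum>j = s k..s (k + 1) - 1. (a j)\<^sup>2) = 0"
    using assms(4) unfolding condition_A1_def by auto
  have diff: "f differentiable (at x within S)" if "x \<in> S" for x
    using assms(5) that unfolding qS_differentiable_on_def S_def by blast
  have form: "d''_form p e q \<epsilon> r s a I J f x v = 0" if "x \<in> S" "v \<in> S" for x v
    using assms(5) that unfolding qS_differentiable_on_def S_def by blast
  have bd: "bounded (f ` S)" using assms(6) by (simp add: S_def)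
  have even_in: "(axis i b, 0) \<in> S" if "i \<in> I" "b \<in> \<Lambda> 0" for i b
    unfolding S_def by (rule axis_in_superspace(1)[OF sub that])
  have odd_in: "(0, axis i b) \<in> S" if "i \<in> J" "b \<in> \<Lambda> 1" for i b
    unfolding S_def by (rule axis_in_superspace(2)[OF sub that])
  \<comment> \<open>The aim is that \<open>P\<close> contains all of \<open>S\<close>. As
    \<open>P\<close> is a subspace, the coordinate basis directions suffice.\<close>
  define P where "P = {w. \<forall>c. c *\<^sub>R w \<in> S \<and> (\<forall>x\<in>S. f (x + c *\<^sub>R w) = f x)}"
  have P: "subspace P" unfolding P_def by (rule subspace_periods[OF S])

  have "(axis i (e k), 0) \<in> P" if i: "i \<in> I" and k: "k \<in> {0..p}" for i k
  proof -
    have CR: "vector_derivative (\<lambda>h. f (x + h *\<^sub>R (axis i (e j), 0))) (at 0) =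
        e j * vector_derivative (\<lambda>h. f (x + h *\<^sub>R (axis i (e 0), 0))) (at 0)"
      if "x \<in> S" "j \<in> {0..p}" for x j
    \<comment> \<open>The index 0 has no equation in d''; there the relation is trivial because
      \<open>e 0\<close> is 1.\<close>
    proof (cases "j = 0")
      case True
      then show ?thesis using e(2) by simp
    next
      case False
      with that have j: "j \<in> {1..p}" by simp
      have "partial_even f i (e j) x - e j * partial_even f i (e 0) x = 0"
        using form[OF that(1) even_in[OF i basis_family_mem[OF e(1) that(2)]]]
        unfolding d''_form_even_basis[where e = e and \<Lambda> = \<Lambda>, OF e(1) i j] .
      then show ?thesis by (simp add: partial_even_def)
    qed
    have "f (x + c *\<^sub>R (axis i (e k), 0)) = f x" if "x \<in> S" for x c
    proof (rule invariant_along_null_directions[where f = f and v = "\<lambda>j. (axis i (e j), 0)" and \<tau> = 0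
          and a = e and T = "{0..p}" and S = S and x = x and t = k and c = c, OF assms(2) S])
      show "(axis i (e j), 0) \<in> S" if "j \<in> {0..p}" for j
        by (rule even_in[OF i basis_family_mem[OF e(1) that]])
      show "e j * e l = e l * e j" if "j \<in> {0..p}" "l \<in> {0..p}" for j l
        by (rule comm[OF basis_family_mem[OF e(1) that(1)] basis_family_mem[OF e(1) that(2)]])
      show "(\<Sum>j\<in>{0..p}. (e j)\<^sup>2) = 0" by (rule e(3))
      show "vector_derivative (\<lambda>h. f (x + h *\<^sub>R (axis i (e j), 0))) (at 0) =
          e j * vector_derivative (\<lambda>h. f (x + h *\<^sub>R (axis i (e 0), 0))) (at 0)"
        if "x \<in> S" "j \<in> {0..p}" for x j
        by (rule CR[OF that])
    qed (use e(2) k that in \<open>auto intro: diff bd\<close>)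
    then show ?thesis
      using even_in[OF i basis_family_mem[OF e(1) k]] subspace_scale[OF S] unfolding P_def by blast
  qed
  then have even: "(axis i b, 0) \<in> P" if "i \<in> I" "b \<in> \<Lambda> 0" for i b
    using basis_family_image_subset[OF e(1) linear_axis(1) P] that by blast

  have "(0, axis i (\<epsilon> j)) \<in> P" if i: "i \<in> J" and j: "j \<in> {1..q}" for i j
  proof -
    \<comment> \<open>The null relation of (A_1) holds block by block, so the argument runs in the
      block containing \<open>j\<close>, with its first index \<open>s k\<close> as reference
      direction.\<close>
    obtain k where k: "k \<in> {1..r}" "s k \<le> j" "j < s (k + 1)"
      using exists_block[of s r q j] s j by blast
    let ?T = "{s k..s (k + 1) - 1}"
    have mono: "s i \<le> s i'" if "i \<le> i'" "i \<in> {1..r+1}" "i' \<in> {1..r+1}" for i i'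
      using strict_mono_onD[OF s(3), of i i'] that by (cases "i = i'") auto
    have T: "t \<in> {1..q}" if "t \<in> ?T" for t
      using mono[of 1 k] mono[of "k + 1" "r + 1"] s k that by auto
    have CR: "vector_derivative (\<lambda>h. f (x + h *\<^sub>R (0, axis i (\<epsilon> t)))) (at 0) =
        a t * vector_derivative (\<lambda>h. f (x + h *\<^sub>R (0, axis i (\<epsilon> (s k))))) (at 0)"
      if "x \<in> S" "t \<in> ?T" for x t
    proof (cases "t = s k")
      case True
      then show ?thesis using a(2)[OF k(1)] by simp
    next
      case False
      with that have t: "t \<in> {s k + 1..s (k + 1) - 1}" by simp
      have "partial_odd f i (\<epsilon> t) x - a t * partial_odd f i (\<epsilon> (s k)) x = 0"
        using form[OF that(1) odd_in[OF i basis_family_mem[OF eps T[OF that(2)]]]]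
        unfolding d''_form_odd_basis[where \<epsilon> = \<epsilon> and \<Lambda> = \<Lambda> and s = s, OF eps i k(1) t s(3,1,2)] .
      then show ?thesis by (simp add: partial_odd_def)
    qed
    have "f (x + c *\<^sub>R (0, axis i (\<epsilon> j))) = f x" if x: "x \<in> S" for x c
    proof (rule invariant_along_null_directions[where f = f and v = "\<lambda>t. (0, axis i (\<epsilon> t))" and \<tau> = "s k"
          and a = a and T = ?T and S = S, OF assms(2) S])
      show "(\<Sum>t\<in>?T. (a t)\<^sup>2) = 0" by (rule a(3)[OF k(1)])
      show "(0, axis i (\<epsilon> t)) \<in> S" if "t \<in> ?T" for t
        by (rule odd_in[OF i basis_family_mem[OF eps T[OF that]]])
      show "a t * a u = a u * a t" if "t \<in> ?T" "u \<in> ?T" for t u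
        by (rule comm[OF a(1)[OF T[OF that(1)]] a(1)[OF T[OF that(2)]]])
      show "vector_derivative (\<lambda>h. f (x + h *\<^sub>R (0, axis i (\<epsilon> t)))) (at 0) =
          a t * vector_derivative (\<lambda>h. f (x + h *\<^sub>R (0, axis i (\<epsilon> (s k))))) (at 0)"
        if "x \<in> S" "t \<in> ?T" for x t
        by (rule CR[OF that])
    qed (use a(2)[OF k(1)] k(2,3) in \<open>auto intro: diff bd x\<close>)
    then show ?thesis
      using odd_in[OF i basis_family_mem[OF eps j]] subspace_scale[OF S] unfolding P_def by blast
  qed
  then have odd: "(0, axis i b) \<in> P" if "i \<in> J" "b \<in> \<Lambda> 1" for i b
    using basis_family_image_subset[OF eps linear_axis(2) P] that by blast

  have "f w = f 0" if "w \<in> S" for w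
  proof -
    obtain y \<theta> where w: "w = (y, \<theta>)" by (cases w)
    with that have *: "\<forall>i\<in>I. y $ i \<in> \<Lambda> 0" "\<forall>i. i \<notin> I \<longrightarrow> y $ i = 0"
      "\<forall>i\<in>J. \<theta> $ i \<in> \<Lambda> 1" "\<forall>i. i \<notin> J \<longrightarrow> \<theta> $ i = 0"
      by (auto simp: S_def superspace_iff)
    \<comment> \<open>A point is the sum of its coordinate vectors, all of them periods; hence it is
      itself a period, and translating the origin by it leaves the value of \<open>f\<close>
      unchanged.\<close>
    have "(\<Sum>i\<in>I. (axis i (y $ i), 0)) + (\<Sum>i\<in>J. (0, axis i (\<theta> $ i))) \<in> P"
      using * even odd by (intro subspace_add[OF P] subspace_sum[OF P]) auto
    then have "w \<in> P" using * w axis_decomposition[of I y J \<theta>] by simp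
    then have "f (0 + 1 *\<^sub>R w) = f 0"
      unfolding P_def using subspace_0[OF S] by blast
    then show ?thesis by simp
  qed
  then show ?thesis unfolding constant_on_def S_def by blast
qed

end
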